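(* For every $k\geq3$, and for the patterns below whenever they are defined (the last three require $k\geq4$), each of the generating functions $$F_{1\mbox{-}2\mbox{-}\cdots\mbox{-}(k-2)\mbox{-}(k-1)k}(x),\quad F_{12\mbox{-}3\mbox{-}\cdots\mbox{-}(k-2)\mbox{-}(k-1)k}(x),\quad F_{2\mbox{-}1\mbox{-}3\mbox{-}\cdots\mbox{-}(k-2)\mbox{-}(k-1)k}(x),\quad F_{21\mbox{-}3\mbox{-}\cdots\mbox{-}(k-2)\mbox{-}(k-1)k}(x)$$ equals $$\frac{1-x-\sqrt{1-2x+x^2-4x^2R_{k-2}(x)}}{2x^2R_{k-2}(x)}.$$
   Context: A generalized pattern is a permutation of $\{1,\dots,k\}$ written as a word $\tau_1\cdots\tau_k$ in which each pair of adjacent letters may or may not be separated by a dash "-". A permutation $\pi=\pi_1\cdots\pi_n\in S_n$ contains $\tau$ if there are indices $i_1<\dots<i_k$ with $(\pi_{i_1},\dots,\pi_{i_k})$ order-isomorphic to $(\tau_1,\dots,\tau_k)$ and $i_{j+1}=i_j+1$ whenever $\tau_j,\tau_{j+1}$ are not separated by a dash; otherwise $\pi$ avoids $\tau$. Thus $1\mbox{-}3\mbox{-}2$ is the classical pattern $132$. $F_\tau(x)=\sum_{n\geq0}f_\tau(n)x^n$, where $f_\tau(n)$ is the number of permutations in $S_n$ ($S_0$ = the empty permutation) avoiding both $1\mbox{-}3\mbox{-}2$ and $\tau$. $U_p(\cos\theta)=\sin((p+1)\theta)/\sin\theta$ is the Chebyshev polynomial of the second kind and $R_p(x)=\dfrac{U_{p-1}\left(\frac{1}{2\sqrt{x}}\right)}{\sqrt{x}\,U_p\left(\frac{1}{2\sqrt{x}}\right)}$.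 *)

theory Defs
  imports
    Complex_Main
    "HOL-Computational_Algebra.Computational_Algebra"
    "HOL-Combinatorics.Multiset_Permutations"
begin

text \<open>
  A generalized pattern is a pair \<open>(\<tau>, D)\<close> of the underlying word and the set of dash positions:
  \<open>d \<in> D\<close> means that a dash separates the first \<open>d\<close> letters of \<open>\<tau>\<close> from the remaining ones.
  A permutation of \<open>{1..n}\<close> is given in one-line notation, as an element of
  \<open>permutations_of_set {1..n}\<close>.
\<close>

type_synonym gpattern = "nat list \<times> nat set"

definition gcontains :: "nat list \<Rightarrow> gpattern \<Rightarrow> bool" where
  "gcontains \<pi> P \<longleftrightarrow> (case P of (\<tau>, D) \<Rightarrow>
     (\<exists>i :: nat \<Rightarrow> nat.
        strict_mono_on {..<length \<tau>} i \<and>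
        (\<forall>a<length \<tau>. i a < length \<pi>) \<and>
        (\<forall>a<length \<tau>. \<forall>b<length \<tau>. \<pi> ! i a < \<pi> ! i b \<longleftrightarrow> \<tau> ! a < \<tau> ! b) \<and>
        (\<forall>d. 0 < d \<and> d < length \<tau> \<and> d \<notin> D \<longrightarrow> i d = i (d - 1) + 1)))"

abbreviation gavoids :: "nat list \<Rightarrow> gpattern \<Rightarrow> bool" where
  "gavoids \<pi> P \<equiv> \<not> gcontains \<pi> P"

definition pat132 :: gpattern where
  "pat132 = ([1, 3, 2], {1, 2})"

definition avoid_count :: "gpattern \<Rightarrow> nat \<Rightarrow> nat" where
  "avoid_count P n =
     card {\<pi> \<in> permutations_of_set {1..n}. gavoids \<pi> pat132 \<and> gavoids \<pi> P}"

definition avoid_gf :: "gpattern \<Rightarrow> real fps" where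
  "avoid_gf P = Abs_fps (\<lambda>n. real (avoid_count P n))"

text \<open>1-2-...-(k-2)-(k-1)k\<close>

definition pat_1_2 :: "nat \<Rightarrow> gpattern" where
  "pat_1_2 k = ([1..<Suc k], {1..k - 2})"

text \<open>12-3-...-(k-2)-(k-1)k\<close>

definition pat_12 :: "nat \<Rightarrow> gpattern" where
  "pat_12 k = ([1..<Suc k], {2..k - 2})"

text \<open>2-1-3-...-(k-2)-(k-1)k\<close>

definition pat_2_1 :: "nat \<Rightarrow> gpattern" where
  "pat_2_1 k = ([2, 1] @ [3..<Suc k], {1..k - 2})"

text \<open>21-3-...-(k-2)-(k-1)k\<close>

definition pat_21 :: "nat \<Rightarrow> gpattern" where
  "pat_21 k = ([2, 1] @ [3..<Suc k], {2..k - 2})"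

definition chebyshev_U :: "nat \<Rightarrow> real poly" where
  "chebyshev_U p =
     (THE q. \<forall>\<theta>. sin \<theta> \<noteq> 0 \<longrightarrow> poly q (cos \<theta>) = sin (real (p + 1) * \<theta>) / sin \<theta>)"

text \<open>
  With \<open>t = \<surd>x\<close>, the expression \<open>U p (1 / (2 \<surd>x))\<close> is the Laurent series \<open>U p (1 / (2 t))\<close> in \<open>t\<close>.
\<close>

definition chebyshev_U_at :: "nat \<Rightarrow> real fls" where
  "chebyshev_U_at p = poly (map_poly fls_const (chebyshev_U p)) (1 / (2 * fls_X))"

text \<open>
  For \<open>p \<ge> 1\<close>, the quotient \<open>U (p - 1) (1 / (2 t)) / (t * U p (1 / (2 t)))\<close> is a power series in
  \<open>t\<^sup>2 = x\<close>, and \<open>cheb_R p\<close> is that series in \<open>x\<close>: the one with \<open>R p (t\<^sup>2)\<close> equal to the quotient.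
\<close>

definition cheb_R :: "nat \<Rightarrow> real fps" where
  "cheb_R p = (THE r. fps_to_fls (r oo fps_X\<^sup>2) =
     chebyshev_U_at (p - 1) / (fls_X * chebyshev_U_at p))"

text \<open>The square root with nonnegative constant term.\<close>

definition fps_sqrt :: "real fps \<Rightarrow> real fps" where
  "fps_sqrt f = fps_radical root 2 f"

fun cheb_rec :: "nat \<Rightarrow> real poly" where
  "cheb_rec 0 = 1"
| "cheb_rec (Suc 0) = [:0, 2:]"
| "cheb_rec (Suc (Suc p)) = [:0, 2:] * cheb_rec (Suc p) - cheb_rec p"

lemma cheb_rec_trig: "poly (cheb_rec p) (cos \<theta>) * sin \<theta> = sin (real (p + 1) * \<theta>)"
proof (induction p rule: cheb_rec.induct)
  case 1
  show ?case by simp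
next
  case 2
  show ?case using sin_double[of \<theta>] by simp
next
  case (3 p)
  define a where "a = real (Suc p + 1) * \<theta>"
  have a1: "real (Suc (Suc p) + 1) * \<theta> = a + \<theta>" and a2: "real (p + 1) * \<theta> = a - \<theta>"
    by (simp_all add: a_def algebra_simps)
  have "poly (cheb_rec (Suc (Suc p))) (cos \<theta>) * sin \<theta> =
        2 * cos \<theta> * (poly (cheb_rec (Suc p)) (cos \<theta>) * sin \<theta>) - poly (cheb_rec p) (cos \<theta>) * sin \<theta>"
    by (simp add: algebra_simps)
  also have "\<dots> = 2 * cos \<theta> * sin a - sin (a - \<theta>)"
    using 3 a2 by (simp only: a_def)
  also have "\<dots> = sin (a + \<theta>)"
    by (simp add: sin_add sin_diff algebra_simps)
  finally show ?case unfolding a1 .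
qed

lemma chebyshev_U_unique:
  assumes "\<forall>\<theta>. sin \<theta> \<noteq> 0 \<longrightarrow> poly q (cos \<theta>) = sin (real (p + 1) * \<theta>) / sin \<theta>"
  shows "q = cheb_rec p"
proof (rule ccontr)
  assume "q \<noteq> cheb_rec p"
  then have fin: "finite {x. poly (q - cheb_rec p) x = 0}"
    by (intro poly_roots_finite) simp
  have "{-1<..<1} \<subseteq> {x. poly (q - cheb_rec p) x = 0}"
  proof
    fix x :: real
    assume x: "x \<in> {-1<..<1}"
    then have "x\<^sup>2 < 1" by (simp add: abs_square_less_1 abs_less_iff)
    then have "sin (arccos x) \<noteq> 0"
      using x by (simp add: sin_arccos)
    moreover have "cos (arccos x) = x" using x by simp
    ultimately have "poly q x = poly (cheb_rec p) x"
      using assms cheb_rec_trig[of p "arccos x"] by (metis nonzero_mult_div_cancel_right)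
    then show "x \<in> {x. poly (q - cheb_rec p) x = 0}" by simp
  qed
  then have "finite {-1<..<1 :: real}" using fin finite_subset by blast
  then show False using infinite_Ioo[of "-1 :: real" 1] by simp
qed

lemma chebyshev_U_eq: "chebyshev_U p = cheb_rec p"
  unfolding chebyshev_U_def
proof (rule the_equality)
  show "\<forall>\<theta>. sin \<theta> \<noteq> 0 \<longrightarrow> poly (cheb_rec p) (cos \<theta>) = sin (real (p + 1) * \<theta>) / sin \<theta>"
    using cheb_rec_trig by (metis nonzero_mult_div_cancel_right)
qed (rule chebyshev_U_unique)

lemma chebyshev_U_trig:
  "sin \<theta> \<noteq> 0 \<Longrightarrow> poly (chebyshev_U p) (cos \<theta>) = sin (real (p + 1) * \<theta>) / sin \<theta>"
  unfolding chebyshev_U_eq using cheb_rec_trig by (metis nonzero_mult_div_cancel_right)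

fun cheb_den :: "nat \<Rightarrow> real fps" where
  "cheb_den 0 = 1"
| "cheb_den (Suc 0) = 1"
| "cheb_den (Suc (Suc p)) = cheb_den (Suc p) - fps_X * cheb_den p"

lemma cheb_den_nth_0 [simp]: "cheb_den p $ 0 = 1"
  by (induction p rule: cheb_den.induct) simp_all

lemma map_poly_fls_const_simps:
  fixes p q :: "real poly"
  shows "map_poly fls_const (p - q) = map_poly fls_const p - map_poly fls_const q"
    and "map_poly fls_const ([:0, 2:] * q) = [:0, 2:] * map_poly fls_const q"
proof -
  show "map_poly fls_const (p - q) = map_poly fls_const p - map_poly fls_const q"
    by (intro poly_eqI) (simp add: coeff_map_poly fls_minus_const)
  have "fls_const (2 * c) = 2 * fls_const c" for c :: real
    by (metis fls_const_mult_const fls_const_numeral)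
  then show "map_poly fls_const ([:0, 2:] * q) = [:0, 2:] * map_poly fls_const q"
    by (intro poly_eqI) (simp add: coeff_map_poly coeff_pCons split: nat.split)
qed

lemma chebyshev_U_at_simps:
  "chebyshev_U_at 0 = 1"
  "chebyshev_U_at (Suc 0) * fls_X = 1"
  "chebyshev_U_at (Suc (Suc p)) * fls_X = chebyshev_U_at (Suc p) - chebyshev_U_at p * fls_X"
proof -
  have half: "2 * (1 / (2 * x)) * x = 1" if "x \<noteq> 0" for x :: "real fls"
    using that by (simp only: times_divide_eq_right mult_1_right divide_self_if mult_eq_0_iff
        times_divide_eq_left) simp
  define y :: "real fls" where "y = 1 / (2 * fls_X)"
  have y: "2 * y * fls_X = 1"
    unfolding y_def by (rule half) simp
  show "chebyshev_U_at 0 = 1"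
    by (simp add: chebyshev_U_at_def chebyshev_U_eq)
  show "chebyshev_U_at (Suc 0) * fls_X = 1"
    unfolding chebyshev_U_at_def chebyshev_U_eq y_def[symmetric]
    using y by (simp add: map_poly_pCons mult.commute)
  have rec: "chebyshev_U_at (Suc (Suc p)) = 2 * y * chebyshev_U_at (Suc p) - chebyshev_U_at p"
    unfolding chebyshev_U_at_def chebyshev_U_eq y_def[symmetric] cheb_rec.simps
      map_poly_fls_const_simps poly_diff poly_mult
    by (simp add: mult.commute)
  have "chebyshev_U_at (Suc (Suc p)) * fls_X =
        (2 * y * fls_X) * chebyshev_U_at (Suc p) - chebyshev_U_at p * fls_X"
    unfolding rec by (simp only: algebra_simps)
  then show "chebyshev_U_at (Suc (Suc p)) * fls_X =
      chebyshev_U_at (Suc p) - chebyshev_U_at p * fls_X"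
    unfolding y by simp
qed

lemma chebyshev_U_at_den:
  "chebyshev_U_at p * fls_X ^ p = fps_to_fls (cheb_den p oo fps_X\<^sup>2)"
proof (induction p rule: cheb_den.induct)
  case 1
  show ?case by (simp add: chebyshev_U_at_simps)
next
  case 2
  show ?case by (simp only: power_Suc0_right power_one_right One_nat_def chebyshev_U_at_simps) simp
next
  case (3 p)
  have "chebyshev_U_at (Suc (Suc p)) * fls_X ^ Suc (Suc p) =
        (chebyshev_U_at (Suc (Suc p)) * fls_X) * fls_X ^ Suc p"
    by (simp only: power_Suc mult_ac)
  also have "\<dots> = chebyshev_U_at (Suc p) * fls_X ^ Suc p - fls_X\<^sup>2 * (chebyshev_U_at p * fls_X ^ p)"
    unfolding chebyshev_U_at_simps by (simp only: power_Suc power2_eq_square algebra_simps)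
  also have "fls_X\<^sup>2 = fps_to_fls (fps_X\<^sup>2 :: real fps)"
    by (simp only: fps_to_fls_power fps_X_to_fls)
  also have "chebyshev_U_at (Suc p) * fls_X ^ Suc p -
      fps_to_fls (fps_X\<^sup>2) * (chebyshev_U_at p * fls_X ^ p) =
      fps_to_fls ((cheb_den (Suc p) oo fps_X\<^sup>2) - fps_X\<^sup>2 * (cheb_den p oo fps_X\<^sup>2))"
    unfolding 3 by (simp only: fls_times_fps_to_fls fps_to_fls_minus)
  also have "(cheb_den (Suc p) oo fps_X\<^sup>2) - fps_X\<^sup>2 * (cheb_den p oo fps_X\<^sup>2) =
      cheb_den (Suc (Suc p)) oo fps_X\<^sup>2"
    by (simp add: fps_compose_sub_distrib fps_compose_mult_distrib)
  finally show ?case .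
qed

lemma cheb_R_eq:
  assumes "p \<ge> 1"
  shows "fps_to_fls ((cheb_den (p - 1) / cheb_den p) oo fps_X\<^sup>2) =
           chebyshev_U_at (p - 1) / (fls_X * chebyshev_U_at p)"
    and "cheb_R p = cheb_den (p - 1) / cheb_den p"
proof -
  let ?d = "\<lambda>p. fps_to_fls (cheb_den p oo fps_X\<^sup>2)"
  let ?r = "cheb_den (p - 1) / cheb_den p"
  have nz: "?d p \<noteq> 0"
  proof
    assume "?d p = 0"
    then have "(cheb_den p oo fps_X\<^sup>2) $ 0 = 0" by simp
    then show False by simp
  qed
  have "?r * cheb_den p = cheb_den (p - 1)"
    by (simp add: fps_divide_unit mult.assoc inverse_mult_eq_1)
  then have "(?r oo fps_X\<^sup>2) * (cheb_den p oo fps_X\<^sup>2) = cheb_den (p - 1) oo fps_X\<^sup>2"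
    by (metis fps_compose_mult_distrib fps_X_power_nth zero_neq_numeral)
  then have "fps_to_fls (?r oo fps_X\<^sup>2) * ?d p = ?d (p - 1)"
    by (metis fls_times_fps_to_fls)
  then have "fps_to_fls (?r oo fps_X\<^sup>2) = ?d (p - 1) / ?d p"
    using nz by (simp add: field_simps)
  also have "\<dots> = chebyshev_U_at (p - 1) / (fls_X * chebyshev_U_at p)"
    using assms unfolding chebyshev_U_at_den[symmetric]
    by (cases p) (simp_all add: field_simps)
  finally show *: "fps_to_fls (?r oo fps_X\<^sup>2) =
      chebyshev_U_at (p - 1) / (fls_X * chebyshev_U_at p)" .
  show "cheb_R p = ?r"
    unfolding cheb_R_def
  proof (rule the_equality)
    show "fps_to_fls (?r oo fps_X\<^sup>2) = chebyshev_U_at (p - 1) / (fls_X * chebyshev_U_at p)"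
      by (rule *)
  next
    fix r :: "real fps"
    assume "fps_to_fls (r oo fps_X\<^sup>2) = chebyshev_U_at (p - 1) / (fls_X * chebyshev_U_at p)"
    then have "r oo fps_X\<^sup>2 = ?r oo fps_X\<^sup>2"
      unfolding *[symmetric] by simp
    then have "(r - ?r) oo fps_X\<^sup>2 = 0"
      by (simp add: fps_compose_sub_distrib)
    then show "r = ?r"
      by (subst (asm) fps_compose_eq_0_iff) auto
  qed
qed

end

theory Submission
  imports Defs "HOL-Library.Tree"
begin

text \<open>
  A permutation avoiding 1-3-2 has the form \<open>\<sigma> n \<rho>\<close> with \<open>n\<close> its maximum and every letter of \<open>\<sigma>\<close>
  above every letter of \<open>\<rho>\<close>, so these permutations are coded by binary trees. Each of the four
  patterns is \<open>\<phi>-(k-1)k\<close> with \<open>\<phi>\<close> of length \<open>k - 2\<close>. Let \<open>F\<close> and \<open>B\<close> count the permutations avoiding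
  1-3-2 together with \<open>\<phi>-(k-1)k\<close> and \<open>\<phi>\<close>, respectively. Since an occurrence of \<open>\<phi>-(k-1)k\<close> lies below
  the top of a single ascent, the decomposition at the maximum yields \<open>F = 1 + x F + x\<^sup>2 B F\<^sup>2\<close>.
  If \<open>\<phi>\<close> is \<open>\<psi>-p\<close> with maximal last letter, the same decomposition gives
  \<open>B\<^sub>\<phi> = 1 + x B\<^sub>\<psi> B\<^sub>\<phi>\<close>, which is the recursion \<open>R\<^sub>p = 1 / (1 - x R\<^sub>p\<^sub>-\<^sub>1)\<close>; hence \<open>B = R\<^sub>k\<^sub>-\<^sub>2\<close>.
\<close>

section \<open>Occurrences in a word split at its maximum\<close>

text \<open>Keeps the embedding \<open>i\<close> of \<open>gcontains\<close> explicit, so that a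
  single occurrence can be shifted, truncated or extended.\<close>

definition occurs_at :: "nat list \<Rightarrow> gpattern \<Rightarrow> (nat \<Rightarrow> nat) \<Rightarrow> bool" where
  "occurs_at \<pi> P i \<longleftrightarrow>
     strict_mono_on {..<length (fst P)} i \<and>
     (\<forall>a<length (fst P). i a < length \<pi>) \<and>
     (\<forall>a<length (fst P). \<forall>b<length (fst P). \<pi> ! i a < \<pi> ! i b \<longleftrightarrow> fst P ! a < fst P ! b) \<and>
     (\<forall>d. 0 < d \<and> d < length (fst P) \<and> d \<notin> snd P \<longrightarrow> i d = i (d - 1) + 1)"

lemma gcontains_iff_occurs_at: "gcontains \<pi> P \<longleftrightarrow> (\<exists>i. occurs_at \<pi> P i)"
  by (cases P) (simp add: gcontains_def occurs_at_def)

lemma occurs_at_append_left: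
  assumes "\<And>a. a < length (fst P) \<Longrightarrow> i a < length \<sigma>"
  shows "occurs_at (\<sigma> @ \<rho>) P i \<longleftrightarrow> occurs_at \<sigma> P i"
  using assms by (auto simp: occurs_at_def nth_append trans_less_add1)

lemma occurs_at_append_right:
  "occurs_at (\<sigma> @ \<rho>) P (\<lambda>a. length \<sigma> + i a) \<longleftrightarrow> occurs_at \<rho> P i"
  by (auto simp: occurs_at_def strict_mono_on_def)

lemma occurs_at_cong:
  assumes "\<And>a. a < length (fst P) \<Longrightarrow> i a = j a"
  shows "occurs_at \<pi> P i \<longleftrightarrow> occurs_at \<pi> P j"
  using assms by (auto simp: occurs_at_def strict_mono_on_def)

text \<open>The added dash sits on the border between \<open>w\<close> and \<open>v\<close>, outside
  the gaps within \<open>w\<close>.\<close>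

lemma occurs_at_prefix:
  assumes i: "occurs_at \<pi> (w @ v, insert (length w) D) i"
  shows "occurs_at \<pi> (w, D) i"
  unfolding occurs_at_def
proof (intro conjI allI impI)
  show "strict_mono_on {..<length (fst (w, D))} i"
    using i by (auto simp: occurs_at_def strict_mono_on_def)
next
  fix a b assume "a < length (fst (w, D))" "b < length (fst (w, D))"
  then show "(\<pi> ! i a < \<pi> ! i b) = (fst (w, D) ! a < fst (w, D) ! b)"
    using i by (auto simp: occurs_at_def nth_append)
qed (use i in \<open>auto simp: occurs_at_def\<close>)

lemma gcontains_append_left: "gcontains \<sigma> P \<Longrightarrow> gcontains (\<sigma> @ \<rho>) P"
  unfolding gcontains_iff_occurs_at
  by (metis occurs_at_append_left occurs_at_def)

lemma gcontains_append_right: "gcontains \<rho> P \<Longrightarrow> gcontains (\<sigma> @ \<rho>) P"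
  unfolding gcontains_iff_occurs_at using occurs_at_append_right by blast

lemma gcontains_order_cong:
  assumes "length \<pi> = length \<pi>'"
    and "\<And>a b. a < length \<pi> \<Longrightarrow> b < length \<pi> \<Longrightarrow> \<pi> ! a < \<pi> ! b \<longleftrightarrow> \<pi>' ! a < \<pi>' ! b"
  shows "gcontains \<pi> P \<longleftrightarrow> gcontains \<pi>' P"
proof -
  have "occurs_at \<pi> P i \<longleftrightarrow> occurs_at \<pi>' P i" for i
    using assms by (auto simp: occurs_at_def)
  then show ?thesis
    by (simp add: gcontains_iff_occurs_at)
qed

text \<open>Only relative order matters, so an appended maximum that leaves a gap in the values may
  be lowered to the next free value.\<close>

lemma gcontains_snoc_max_cong:
  assumes "\<forall>x\<in>set \<sigma>. x < m" "\<forall>x\<in>set \<sigma>. x < n"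
  shows "gcontains (\<sigma> @ [m]) P \<longleftrightarrow> gcontains (\<sigma> @ [n]) P"
proof (rule gcontains_order_cong)
  fix a b assume "a < length (\<sigma> @ [m])" "b < length (\<sigma> @ [m])"
  then have "a < length \<sigma> \<or> a = length \<sigma>" "b < length \<sigma> \<or> b = length \<sigma>" by auto
  moreover have "\<sigma> ! a < m" "\<sigma> ! a < n" if "a < length \<sigma>" for a
    using assms that by auto
  ultimately show "(\<sigma> @ [m]) ! a < (\<sigma> @ [m]) ! b \<longleftrightarrow> (\<sigma> @ [n]) ! a < (\<sigma> @ [n]) ! b"
    by (metis nth_append_left nth_append_length order.asym order.irrefl)
qed simp

text \<open>For empty \<open>w\<close>, the set \<open>insert (length w) D\<close> contains the
  position 0, where there is no gap. This lets the one- and two-letter base patterns be read in that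
  form.\<close>

lemma gcontains_dash_cong:
  assumes "\<And>d. 0 < d \<Longrightarrow> d < length w \<Longrightarrow> d \<in> D \<longleftrightarrow> d \<in> D'"
  shows "gcontains \<pi> (w, D) \<longleftrightarrow> gcontains \<pi> (w, D')"
proof -
  have "occurs_at \<pi> (w, D) i \<longleftrightarrow> occurs_at \<pi> (w, D') i" for i
    using assms by (auto simp: occurs_at_def)
  then show ?thesis
    by (simp add: gcontains_iff_occurs_at)
qed

lemma gcontains_empty_pattern: "gcontains \<pi> ([], D)"
  by (auto simp: gcontains_iff_occurs_at occurs_at_def)

lemma gcontains_Nil: "w \<noteq> [] \<Longrightarrow> gavoids [] (w, D)"
  by (auto simp: gcontains_iff_occurs_at occurs_at_def)

section \<open>Occurrences to the left of and below a position\<close>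

text \<open>This is the condition for position \<open>j\<close> to serve as a next, largest letter
  after a dash.\<close>

definition occurs_below :: "nat list \<Rightarrow> gpattern \<Rightarrow> nat \<Rightarrow> bool" where
  "occurs_below \<pi> P j \<longleftrightarrow>
     (\<exists>i. occurs_at \<pi> P i \<and> (\<forall>a<length (fst P). i a < j \<and> \<pi> ! i a < \<pi> ! j))"

lemma occurs_below_append_left:
  assumes "j < length \<sigma>"
  shows "occurs_below (\<sigma> @ \<rho>) P j \<longleftrightarrow> occurs_below \<sigma> P j"
proof -
  have "occurs_at (\<sigma> @ \<rho>) P i \<and> (\<forall>a<length (fst P). i a < j \<and> (\<sigma> @ \<rho>) ! i a < (\<sigma> @ \<rho>) ! j) \<longleftrightarrow>
        occurs_at \<sigma> P i \<and> (\<forall>a<length (fst P). i a < j \<and> \<sigma> ! i a < \<sigma> ! j)" for i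
  proof (cases "\<forall>a<length (fst P). i a < j")
    case True
    then have "occurs_at (\<sigma> @ \<rho>) P i \<longleftrightarrow> occurs_at \<sigma> P i"
      using assms by (intro occurs_at_append_left) auto
    then show ?thesis
      using True assms by (auto simp: nth_append)
  qed auto
  then show ?thesis
    by (simp add: occurs_below_def)
qed

text \<open>A copy below \<open>\<rho> ! j\<close> can use no letter of \<open>\<sigma>\<close>, as
  all of these are larger.\<close>

lemma occurs_below_append_right:
  assumes less: "\<forall>y\<in>set \<sigma>. \<rho> ! j < y"
  shows "occurs_below (\<sigma> @ \<rho>) P (length \<sigma> + j) \<longleftrightarrow> occurs_below \<rho> P j"
proof
  assume "occurs_below (\<sigma> @ \<rho>) P (length \<sigma> + j)"
  then obtain i where i: "occurs_at (\<sigma> @ \<rho>) P i"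
    "\<And>a. a < length (fst P) \<Longrightarrow> i a < length \<sigma> + j \<and> (\<sigma> @ \<rho>) ! i a < \<rho> ! j"
    unfolding occurs_below_def by auto
  have ge: "length \<sigma> \<le> i a" if "a < length (fst P)" for a
  proof (rule ccontr)
    assume "\<not> length \<sigma> \<le> i a"
    then have "\<sigma> ! i a < \<rho> ! j" "\<sigma> ! i a \<in> set \<sigma>"
      using i(2)[OF that] by (auto simp: nth_append)
    then show False
      using less by auto
  qed
  \<comment> \<open>By \<open>ge\<close> the subtraction is undone; in this form the index shift of
    \<open>occurs_at_append_right\<close> applies.\<close>
  have "occurs_at (\<sigma> @ \<rho>) P (\<lambda>a. length \<sigma> + (i a - length \<sigma>))"
    using i(1) ge by (subst occurs_at_cong[where j = i]) auto
  then have "occurs_at \<rho> P (\<lambda>a. i a - length \<sigma>)"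
    by (simp only: occurs_at_append_right)
  moreover have "i a - length \<sigma> < j \<and> \<rho> ! (i a - length \<sigma>) < \<rho> ! j"
    if "a < length (fst P)" for a
    using i(2)[OF that] ge[OF that] by (auto simp: nth_append)
  ultimately show "occurs_below \<rho> P j"
    unfolding occurs_below_def by blast
next
  assume "occurs_below \<rho> P j"
  then obtain i where "occurs_at \<rho> P i"
    "\<forall>a<length (fst P). i a < j \<and> \<rho> ! i a < \<rho> ! j"
    unfolding occurs_below_def by auto
  then show "occurs_below (\<sigma> @ \<rho>) P (length \<sigma> + j)"
    unfolding occurs_below_def
    by (intro exI[of _ "\<lambda>a. length \<sigma> + i a"]) (simp add: occurs_at_append_right)
qed

lemma occurs_below_imp_gcontains: "occurs_below \<pi> P j \<Longrightarrow> gcontains \<pi> P"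
  by (auto simp: occurs_below_def gcontains_iff_occurs_at)

lemma occurs_below_max:
  assumes "\<forall>x\<in>set \<sigma>. x < n"
  shows "occurs_below (\<sigma> @ n # \<rho>) P (length \<sigma>) \<longleftrightarrow> gcontains \<sigma> P"
proof
  assume "occurs_below (\<sigma> @ n # \<rho>) P (length \<sigma>)"
  then show "gcontains \<sigma> P"
    unfolding occurs_below_def gcontains_iff_occurs_at using occurs_at_append_left by blast
next
  assume "gcontains \<sigma> P"
  then obtain i where i: "occurs_at \<sigma> P i"
    unfolding gcontains_iff_occurs_at by blast
  then have "\<forall>a<length (fst P). i a < length \<sigma>"
    by (simp add: occurs_at_def)
  then show "occurs_below (\<sigma> @ n # \<rho>) P (length \<sigma>)"
    unfolding occurs_below_def using i assms
    by (intro exI[of _ i]) (simp add: occurs_at_append_left nth_append)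
qed

text \<open>After a dash, \<open>m\<close> may be played by any later position with a larger
  value.\<close>

lemma gcontains_snoc_dash_iff:
  assumes w: "\<forall>x\<in>set w. x < m"
  shows "gcontains \<pi> (w @ [m], insert (length w) D) \<longleftrightarrow>
         (\<exists>j<length \<pi>. occurs_below \<pi> (w, D) j)"
proof
  assume "gcontains \<pi> (w @ [m], insert (length w) D)"
  then obtain i where i: "occurs_at \<pi> (w @ [m], insert (length w) D) i"
    unfolding gcontains_iff_occurs_at by blast
  have "occurs_at \<pi> (w, D) i"
    using i by (rule occurs_at_prefix)
  moreover have "i a < i (length w) \<and> \<pi> ! i a < \<pi> ! i (length w)" if "a < length w" for a
  proof
    show "i a < i (length w)"
      using i that by (auto simp: occurs_at_def strict_mono_on_def)
    have "(w @ [m]) ! a < (w @ [m]) ! length w"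
      using that w by (simp add: nth_append)
    then show "\<pi> ! i a < \<pi> ! i (length w)"
      using i that by (auto simp: occurs_at_def)
  qed
  ultimately show "\<exists>j<length \<pi>. occurs_below \<pi> (w, D) j"
    using i unfolding occurs_below_def
    by (intro exI[of _ "i (length w)"]) (auto simp: occurs_at_def)
next
  assume "\<exists>j<length \<pi>. occurs_below \<pi> (w, D) j"
  then obtain i j where j: "j < length \<pi>" and i: "occurs_at \<pi> (w, D) i"
    and ij: "\<And>a. a < length w \<Longrightarrow> i a < j \<and> \<pi> ! i a < \<pi> ! j"
    unfolding occurs_below_def by auto
  have m: "w ! a < m" if "a < length w" for a
    using that w by simp
  have ord: "\<pi> ! i a < \<pi> ! i b \<longleftrightarrow> w ! a < w ! b" if "a < length w" "b < length w" for a b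
    using i that by (simp add: occurs_at_def)
  have "occurs_at \<pi> (w @ [m], insert (length w) D) (i(length w := j))"
    unfolding occurs_at_def
  proof (intro conjI allI impI)
    show "strict_mono_on {..<length (fst (w @ [m], insert (length w) D))} (i(length w := j))"
      using i ij by (auto simp: occurs_at_def strict_mono_on_def)
  next
    fix a b assume "a < length (fst (w @ [m], insert (length w) D))"
      "b < length (fst (w @ [m], insert (length w) D))"
    then have "a < length w \<or> a = length w" "b < length w \<or> b = length w" by auto
    then show "(\<pi> ! (i(length w := j)) a < \<pi> ! (i(length w := j)) b) =
      (fst (w @ [m], insert (length w) D) ! a < fst (w @ [m], insert (length w) D) ! b)"
      by (elim disjE)
        (simp_all add: nth_append ord ij m less_not_sym[OF m] less_not_sym[OF conjunct2[OF ij]])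
  next
    fix a assume "a < length (fst (w @ [m], insert (length w) D))"
    then have "a < length w \<or> a = length w" by auto
    then show "(i(length w := j)) a < length \<pi>"
      using j i by (auto simp: occurs_at_def)
  next
    fix d assume "0 < d \<and> d < length (fst (w @ [m], insert (length w) D)) \<and>
      d \<notin> snd (w @ [m], insert (length w) D)"
    then have d: "0 < d" "d < length w" "d \<notin> D" by auto
    then have "i d = i (d - 1) + 1"
      using i by (simp add: occurs_at_def)
    then show "(i(length w := j)) d = (i(length w := j)) (d - 1) + 1"
      using d by auto
  qed
  then show "gcontains \<pi> (w @ [m], insert (length w) D)"
    unfolding gcontains_iff_occurs_at by blast
qed

text \<open>The last two letters form an ascent. Its top exceeds whatever its bottom exceeds, so
  only the bottom has to be compared with the copy of \<open>w\<close>. The bound on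
  \<open>D\<close> keeps these two letters adjacent.\<close>

lemma gcontains_append_ascent_iff:
  assumes w: "\<forall>x\<in>set w. x < m" and "m < m'" and D: "D \<subseteq> {..length w}"
  shows "gcontains \<pi> (w @ [m, m'], insert (length w) D) \<longleftrightarrow>
         (\<exists>j. Suc j < length \<pi> \<and> \<pi> ! j < \<pi> ! Suc j \<and> occurs_below \<pi> (w, D) j)"
    (is "gcontains \<pi> ?P \<longleftrightarrow> _")
proof
  let ?p = "length w"
  assume "gcontains \<pi> ?P"
  then obtain i where i: "occurs_at \<pi> ?P i"
    unfolding gcontains_iff_occurs_at by blast
  have "occurs_at \<pi> (w, D) i"
    using i by (rule occurs_at_prefix)
  moreover have "i a < i ?p \<and> \<pi> ! i a < \<pi> ! i ?p" if "a < ?p" for a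
  proof
    show "i a < i ?p"
      using i that by (auto simp: occurs_at_def strict_mono_on_def)
    have "fst ?P ! a < fst ?P ! ?p"
      using that w by (simp add: nth_append)
    then show "\<pi> ! i a < \<pi> ! i ?p"
      using i that by (auto simp: occurs_at_def)
  qed
  moreover have "i (Suc ?p) = Suc (i ?p)"
  proof -
    have "Suc ?p \<notin> snd ?P"
      using D by auto
    then have "i (Suc ?p) = i (Suc ?p - 1) + 1"
      using i unfolding occurs_at_def by (metis append.assoc fst_conv length_append_singleton
        append_Cons append_Nil lessI zero_less_Suc)
    then show ?thesis by simp
  qed
  moreover have "\<pi> ! i ?p < \<pi> ! i (Suc ?p)"
  proof -
    have "fst ?P ! ?p < fst ?P ! Suc ?p"
      using \<open>m < m'\<close> by (simp add: nth_append)
    then show ?thesis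
      using i by (auto simp: occurs_at_def)
  qed
  moreover have "i (Suc ?p) < length \<pi>"
    using i by (simp add: occurs_at_def)
  ultimately show "\<exists>j. Suc j < length \<pi> \<and> \<pi> ! j < \<pi> ! Suc j \<and> occurs_below \<pi> (w, D) j"
    unfolding occurs_below_def by (intro exI[of _ "i ?p"]) auto
next
  let ?p = "length w"
  assume "\<exists>j. Suc j < length \<pi> \<and> \<pi> ! j < \<pi> ! Suc j \<and> occurs_below \<pi> (w, D) j"
  then obtain i j where j: "Suc j < length \<pi>" "\<pi> ! j < \<pi> ! Suc j" and i: "occurs_at \<pi> (w, D) i"
    and ij: "\<And>a. a < ?p \<Longrightarrow> i a < j \<and> \<pi> ! i a < \<pi> ! j"
    unfolding occurs_below_def by auto
  have m: "w ! a < m" if "a < ?p" for a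
    using that w by simp
  have m': "w ! a < m'" if "a < ?p" for a
    using m[OF that] \<open>m < m'\<close> by simp
  have ij': "i a < Suc j \<and> \<pi> ! i a < \<pi> ! Suc j" if "a < ?p" for a
    using ij[OF that] j by simp
  have ord: "\<pi> ! i a < \<pi> ! i b \<longleftrightarrow> w ! a < w ! b" if "a < ?p" "b < ?p" for a b
    using i that by (simp add: occurs_at_def)
  define i' where "i' = i(?p := j, Suc ?p := Suc j)"
  have "occurs_at \<pi> ?P i'"
    unfolding occurs_at_def
  proof (intro conjI allI impI)
    show "strict_mono_on {..<length (fst ?P)} i'"
      using i ij ij' by (auto simp: i'_def occurs_at_def strict_mono_on_def)
  next
    fix a b assume "a < length (fst ?P)" "b < length (fst ?P)"
    then have "a < ?p \<or> a = ?p \<or> a = Suc ?p" "b < ?p \<or> b = ?p \<or> b = Suc ?p" by auto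
    then show "(\<pi> ! i' a < \<pi> ! i' b) = (fst ?P ! a < fst ?P ! b)"
      by (elim disjE)
        (simp_all add: i'_def nth_append ord ij m ij' m' j \<open>m < m'\<close> less_not_sym[OF m]
          less_not_sym[OF m'] less_not_sym[OF \<open>m < m'\<close>] less_not_sym[OF j(2)]
          less_not_sym[OF conjunct2[OF ij]] less_not_sym[OF conjunct2[OF ij']])
  next
    fix a assume "a < length (fst ?P)"
    then have "a < ?p \<or> a = ?p \<or> a = Suc ?p" by auto
    then show "i' a < length \<pi>"
      using j i by (auto simp: i'_def occurs_at_def)
  next
    fix d assume d: "0 < d \<and> d < length (fst ?P) \<and> d \<notin> snd ?P"
    then consider "d < ?p" | "d = Suc ?p" by fastforce
    then show "i' d = i' (d - 1) + 1"
    proof cases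
      case 1
      then have "i d = i (d - 1) + 1"
        using i d by (simp add: occurs_at_def)
      then show ?thesis
        using 1 by (auto simp: i'_def)
    qed (simp add: i'_def)
  qed
  then show "gcontains \<pi> ?P"
    unfolding gcontains_iff_occurs_at by blast
qed


section \<open>The patterns in a word cut at or after its maximum\<close>

text \<open>Split by the position of the letter that plays \<open>m\<close>. In
  \<open>\<sigma>\<close> or at \<open>n\<close>, it leaves a copy of \<open>w\<close> in
  \<open>\<sigma>\<close>; in \<open>\<rho>\<close>, the copy below it must lie in
  \<open>\<rho>\<close> too. Conversely, \<open>n\<close> completes any copy of \<open>w\<close> in
  \<open>\<sigma>\<close>.\<close>

lemma gcontains_snoc_dash_max:
  assumes w: "\<forall>x\<in>set w. x < m"
    and n: "\<forall>x\<in>set \<sigma> \<union> set \<rho>. x < n"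
    and less: "\<forall>x\<in>set \<rho>. \<forall>y\<in>set \<sigma>. x < y"
  shows "gcontains (\<sigma> @ n # \<rho>) (w @ [m], insert (length w) D) \<longleftrightarrow>
         gcontains \<sigma> (w, D) \<or> gcontains \<rho> (w @ [m], insert (length w) D)"
    (is "?L \<longleftrightarrow> ?R")
proof
  assume ?L
  then obtain j where j: "j < length (\<sigma> @ n # \<rho>)" "occurs_below (\<sigma> @ n # \<rho>) (w, D) j"
    using gcontains_snoc_dash_iff[OF w] by blast
  consider "j < length \<sigma>" | "j = length \<sigma>"
    | j' where "j = length (\<sigma> @ [n]) + j'" "j' < length \<rho>"
  proof (cases "length \<sigma> < j")
    case True
    then have "j = length (\<sigma> @ [n]) + (j - Suc (length \<sigma>))" "j - Suc (length \<sigma>) < length \<rho>"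
      using j(1) by auto
    then show ?thesis using that(3) by blast
  qed (use that in fastforce)
  then show ?R
  proof cases
    case 1
    then show ?thesis
      using j(2) occurs_below_append_left occurs_below_imp_gcontains by blast
  next
    case 2
    then show ?thesis
      using j(2) n occurs_below_max by blast
  next
    case 3
    then have "occurs_below ((\<sigma> @ [n]) @ \<rho>) (w, D) (length (\<sigma> @ [n]) + j')"
      using j(2) by simp
    then have "occurs_below \<rho> (w, D) j'"
      by (subst (asm) occurs_below_append_right) (use 3 n less in auto)
    then show ?thesis
      using 3 gcontains_snoc_dash_iff[OF w] by blast
  qed
next
  assume ?R
  then show ?L
  proof
    assume "gcontains \<sigma> (w, D)"
    then have "occurs_below (\<sigma> @ n # \<rho>) (w, D) (length \<sigma>)"
      using n by (subst occurs_below_max) auto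
    then show ?L
      unfolding gcontains_snoc_dash_iff[OF w] by (intro exI[of _ "length \<sigma>"]) simp
  next
    assume "gcontains \<rho> (w @ [m], insert (length w) D)"
    then show ?L
      using gcontains_append_right[of _ _ "\<sigma> @ [n]"] by simp
  qed
qed

text \<open>
  No occurrence crosses the cut: the ascent lies on one side of it, and everything below an ascent
  of \<open>\<beta>\<close> is again in \<open>\<beta>\<close>. Only the last letter of \<open>\<beta>\<close> may exceed letters of \<open>\<alpha>\<close>.
\<close>

lemma gcontains_ascent_append:
  assumes w: "\<forall>x\<in>set w. x < m" "m < m'" "D \<subseteq> {..length w}"
    and cut: "\<beta> \<noteq> [] \<Longrightarrow> \<alpha> \<noteq> [] \<Longrightarrow> hd \<beta> < last \<alpha>"
    and less: "\<forall>j y. Suc j < length \<beta> \<longrightarrow> y \<in> set \<alpha> \<longrightarrow> \<beta> ! j < y"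
  shows "gcontains (\<alpha> @ \<beta>) (w @ [m, m'], insert (length w) D) \<longleftrightarrow>
         gcontains \<alpha> (w @ [m, m'], insert (length w) D) \<or>
         gcontains \<beta> (w @ [m, m'], insert (length w) D)"
proof
  note iff = gcontains_append_ascent_iff[OF w]
  assume "gcontains (\<alpha> @ \<beta>) (w @ [m, m'], insert (length w) D)"
  then obtain j where j: "Suc j < length (\<alpha> @ \<beta>)" "(\<alpha> @ \<beta>) ! j < (\<alpha> @ \<beta>) ! Suc j"
    "occurs_below (\<alpha> @ \<beta>) (w, D) j"
    using iff by blast
  consider "Suc j < length \<alpha>" | "Suc j = length \<alpha>" "\<beta> \<noteq> []"
    | j' where "j = length \<alpha> + j'" "Suc j' < length \<beta>"
  proof (cases "length \<alpha> < Suc j")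
    case True
    then have "j = length \<alpha> + (j - length \<alpha>)" "Suc (j - length \<alpha>) < length \<beta>"
      using j(1) by auto
    then show ?thesis using that(3) by blast
  next
    case False
    then show ?thesis using j(1) that(1,2) by (cases "Suc j = length \<alpha>") auto
  qed
  then show "gcontains \<alpha> (w @ [m, m'], insert (length w) D) \<or>
             gcontains \<beta> (w @ [m, m'], insert (length w) D)"
  proof cases
    case 1
    then have "\<alpha> ! j < \<alpha> ! Suc j" "occurs_below \<alpha> (w, D) j"
      using j by (simp_all add: nth_append occurs_below_append_left)
    then show ?thesis
      using 1 iff by blast
  next
    case 2
    then have ne: "\<alpha> \<noteq> []" and j': "j = length \<alpha> - 1" "j < length \<alpha>" by auto
    moreover have "(\<alpha> @ \<beta>) ! j = last \<alpha>"
      using ne j' by (simp add: nth_append last_conv_nth)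
    moreover have "(\<alpha> @ \<beta>) ! Suc j = hd \<beta>"
      using 2 by (simp add: nth_append hd_conv_nth)
    ultimately show ?thesis
      using j(2) cut 2 by auto
  next
    case 3
    then have "\<beta> ! j' < \<beta> ! Suc j'" "occurs_below \<beta> (w, D) j'"
      using j less by (simp_all add: nth_append occurs_below_append_right)
    then show ?thesis
      using 3 iff by blast
  qed
qed (use gcontains_append_left gcontains_append_right in blast)

text \<open>\<open>n\<close> and \<open>n'\<close> supply the final ascent above any copy of
  \<open>w\<close> in \<open>\<sigma>\<close>. Conversely, the bottom of an ascent lies in
  \<open>\<sigma>\<close> or is \<open>n\<close>, so the copy below it lies in
  \<open>\<sigma>\<close>.\<close>

lemma gcontains_ascent_snoc_max:
  assumes w: "\<forall>x\<in>set w. x < m" "m < m'" "D \<subseteq> {..length w}"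
    and n: "\<forall>x\<in>set \<sigma>. x < n" "n < n'"
  shows "gcontains (\<sigma> @ [n, n']) (w @ [m, m'], insert (length w) D) \<longleftrightarrow> gcontains \<sigma> (w, D)"
proof
  note iff = gcontains_append_ascent_iff[OF w]
  assume "gcontains (\<sigma> @ [n, n']) (w @ [m, m'], insert (length w) D)"
  then obtain j where j: "Suc j < length (\<sigma> @ [n, n'])" "occurs_below (\<sigma> @ [n, n']) (w, D) j"
    using iff by blast
  then consider "j < length \<sigma>" | "j = length \<sigma>" by fastforce
  then show "gcontains \<sigma> (w, D)"
  proof cases
    case 1
    then show ?thesis
      using j(2) occurs_below_append_left occurs_below_imp_gcontains by blast
  next
    case 2
    then show ?thesis
      using j(2) n occurs_below_max by blast
  qed
next
  note iff = gcontains_append_ascent_iff[OF w]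
  assume "gcontains \<sigma> (w, D)"
  then have "occurs_below (\<sigma> @ [n, n']) (w, D) (length \<sigma>)"
    using n by (subst occurs_below_max) auto
  then show "gcontains (\<sigma> @ [n, n']) (w @ [m, m'], insert (length w) D)"
    using n(2) unfolding iff by (intro exI[of _ "length \<sigma>"]) (simp add: nth_append)
qed

text \<open>A maximum followed by some letter is an adjacent descent and so realizes both 21 and
  2-1; a maximum in last place creates no new occurrence.\<close>

lemma gcontains_descent_max:
  assumes D: "D \<subseteq> {1}" and n: "\<forall>x\<in>set \<sigma> \<union> set \<rho>. x < n"
  shows "gcontains (\<sigma> @ n # \<rho>) ([2, 1], D) \<longleftrightarrow> gcontains \<sigma> ([2, 1], D) \<or> \<rho> \<noteq> []"
proof
  assume L: "gcontains (\<sigma> @ n # \<rho>) ([2, 1], D)"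
  show "gcontains \<sigma> ([2, 1], D) \<or> \<rho> \<noteq> []"
  proof (cases "\<rho> = []")
    case True
    then obtain i where i: "occurs_at (\<sigma> @ [n]) ([2, 1], D) i"
      using L by (auto simp: gcontains_iff_occurs_at)
    have 1: "i 0 < i 1" "i 1 \<le> length \<sigma>" "(\<sigma> @ [n]) ! i 1 < (\<sigma> @ [n]) ! i 0"
      using i by (auto simp: occurs_at_def strict_mono_on_def less_Suc_eq_le)
    then have "(\<sigma> @ [n]) ! i 0 \<in> set \<sigma>"
      by (simp add: nth_append)
    \<comment> \<open>The final maximum cannot be the smaller letter of a descent.\<close>
    then have "i 1 \<noteq> length \<sigma>"
      using 1 n by (metis UnI1 nth_append_length order.asym)
    with 1 have "i a < length \<sigma>" if "a < length (fst ([2, 1] :: nat list, D))" for a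
      using that by (cases a) auto
    then show ?thesis
      using i occurs_at_append_left unfolding gcontains_iff_occurs_at by blast
  qed simp
next
  assume "gcontains \<sigma> ([2, 1], D) \<or> \<rho> \<noteq> []"
  then show "gcontains (\<sigma> @ n # \<rho>) ([2, 1], D)"
  proof
    assume "\<rho> \<noteq> []"
    then obtain x \<rho>' where "\<rho> = x # \<rho>'" "x < n"
      using n by (cases \<rho>) auto
    then have "occurs_at (n # \<rho>) ([2, 1], D) (\<lambda>a. a)"
      by (simp add: occurs_at_def strict_mono_on_def numeral_2_eq_2 All_less_Suc)
    then show ?thesis
      using gcontains_append_right unfolding gcontains_iff_occurs_at by blast
  qed (rule gcontains_append_left)
qed

section \<open>The pattern 1-3-2\<close>

lemma gcontains_pat132_iff:
  "gcontains \<pi> pat132 \<longleftrightarrow>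
     (\<exists>a b c. a < b \<and> b < c \<and> c < length \<pi> \<and> \<pi> ! a < \<pi> ! c \<and> \<pi> ! c < \<pi> ! b)"
proof
  assume "gcontains \<pi> pat132"
  then obtain i where i: "occurs_at \<pi> ([1, 3, 2], {1, 2}) i"
    unfolding gcontains_iff_occurs_at pat132_def by blast
  then have "i 0 < i 1" "i 1 < i 2" "i 2 < length \<pi>"
    by (auto simp: occurs_at_def strict_mono_on_def)
  moreover have "\<pi> ! i 0 < \<pi> ! i 2" "\<pi> ! i 2 < \<pi> ! i 1"
    using i by (auto simp: occurs_at_def)
  ultimately show "\<exists>a b c. a < b \<and> b < c \<and> c < length \<pi> \<and> \<pi> ! a < \<pi> ! c \<and> \<pi> ! c < \<pi> ! b"
    by blast
next
  assume "\<exists>a b c. a < b \<and> b < c \<and> c < length \<pi> \<and> \<pi> ! a < \<pi> ! c \<and> \<pi> ! c < \<pi> ! b"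
  then obtain a b c where "a < b" "b < c" "c < length \<pi>" "\<pi> ! a < \<pi> ! c" "\<pi> ! c < \<pi> ! b"
    by blast
  then have "occurs_at \<pi> ([1, 3, 2], {1, 2}) ((!) [a, b, c])"
    by (auto simp: occurs_at_def strict_mono_on_def less_Suc_eq)
  then show "gcontains \<pi> pat132"
    unfolding gcontains_iff_occurs_at pat132_def by blast
qed

text \<open>A letter of \<open>\<sigma>\<close>, then \<open>n\<close>, then a larger letter of
  \<open>\<rho>\<close> form the pattern. An occurrence that starts in \<open>\<sigma>\<close> and
  ends in \<open>\<rho>\<close> yields such a pair; as \<open>n\<close> can play neither the 1 nor
  the 2, any other occurrence lies on one side of it.\<close>

lemma gcontains_pat132_max:
  assumes n: "\<forall>x\<in>set \<sigma> \<union> set \<rho>. x < n"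
  shows "gcontains (\<sigma> @ n # \<rho>) pat132 \<longleftrightarrow>
         gcontains \<sigma> pat132 \<or> gcontains \<rho> pat132 \<or> (\<exists>x\<in>set \<sigma>. \<exists>y\<in>set \<rho>. x < y)"
proof
  let ?\<pi> = "\<sigma> @ n # \<rho>"
  assume "gcontains ?\<pi> pat132"
  then obtain a b c where abc: "a < b" "b < c" "c < length ?\<pi>" "?\<pi> ! a < ?\<pi> ! c" "?\<pi> ! c < ?\<pi> ! b"
    unfolding gcontains_pat132_iff by blast
  have le: "?\<pi> ! i \<le> n" if "i < length ?\<pi>" for i
    using n nth_mem[OF that] by (auto simp: less_imp_le)
  have "a \<noteq> length \<sigma>" "c \<noteq> length \<sigma>"
    using abc le[of b] le[of c] by auto
  then consider "c < length \<sigma>" | "a < length \<sigma>" "length \<sigma> < c" | "length \<sigma> < a"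
    using abc by linarith
  then show "gcontains \<sigma> pat132 \<or> gcontains \<rho> pat132 \<or> (\<exists>x\<in>set \<sigma>. \<exists>y\<in>set \<rho>. x < y)"
  proof cases
    case 1
    then have "\<sigma> ! a < \<sigma> ! c" "\<sigma> ! c < \<sigma> ! b"
      using abc by (simp_all add: nth_append)
    then show ?thesis
      using abc(1,2) 1 unfolding gcontains_pat132_iff by blast
  next
    case 2
    then have "?\<pi> ! a \<in> set \<sigma>" "?\<pi> ! c \<in> set \<rho>"
      using abc(3) by (auto simp: nth_append nth_Cons')
    then show ?thesis
      using abc(4) by blast
  next
    case 3
    define s where "s = Suc (length \<sigma>)"
    have nth: "?\<pi> ! i = \<rho> ! (i - s)" if "s \<le> i" for i
      using that by (auto simp: s_def nth_append nth_Cons')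
    have "s \<le> a" using 3 by (simp add: s_def)
    then have "a - s < b - s \<and> b - s < c - s \<and> c - s < length \<rho> \<and>
      \<rho> ! (a - s) < \<rho> ! (c - s) \<and> \<rho> ! (c - s) < \<rho> ! (b - s)"
      using abc nth[of a] nth[of b] nth[of c] by (auto simp: s_def)
    then show ?thesis
      unfolding gcontains_pat132_iff by blast
  qed
next
  assume "gcontains \<sigma> pat132 \<or> gcontains \<rho> pat132 \<or> (\<exists>x\<in>set \<sigma>. \<exists>y\<in>set \<rho>. x < y)"
  then consider "gcontains \<sigma> pat132" | "gcontains \<rho> pat132"
    | a c where "a < length \<sigma>" "c < length \<rho>" "\<sigma> ! a < \<rho> ! c"
    by (metis in_set_conv_nth)
  then show "gcontains (\<sigma> @ n # \<rho>) pat132"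
  proof cases
    case 1
    then show ?thesis by (rule gcontains_append_left)
  next
    case 2
    then show ?thesis
      using gcontains_append_right[of _ _ "\<sigma> @ [n]"] by simp
  next
    case 3
    then show ?thesis
      unfolding gcontains_pat132_iff using n
      by (intro exI[of _ a] exI[of _ "length \<sigma>"] exI[of _ "Suc (length \<sigma>) + c"])
        (simp add: nth_append)
  qed
qed

section \<open>Coding by binary trees\<close>

text \<open>In-order reading in which each root is the largest letter of its block and the right
  subtree gets the smaller values. The offset \<open>c\<close> lets each subtree fill an interval of
  its own.\<close>

fun tree_word :: "nat \<Rightarrow> unit tree \<Rightarrow> nat list" where
  "tree_word c Leaf = []"
| "tree_word c (Node l _ r) = tree_word (c + size r) l @ (c + size l + size r + 1) # tree_word c r"

lemma length_tree_word [simp]: "length (tree_word c t) = size t"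
  by (induction t arbitrary: c) auto

lemma set_tree_word [simp]: "set (tree_word c t) = {c<..c + size t}"
  by (induction t arbitrary: c) auto

lemma distinct_tree_word: "distinct (tree_word c t)"
  by (induction t arbitrary: c) auto

text \<open>The letters of a left subtree fill the interval above those of the right one, so no
  1-3-2 straddles a root.\<close>

lemma gavoids_pat132_tree_word: "gavoids (tree_word c t) pat132"
proof (induction t arbitrary: c)
  case Leaf
  show ?case by (simp add: gcontains_pat132_iff)
next
  case (Node l a r)
  then show ?case
    unfolding tree_word.simps by (subst gcontains_pat132_max) auto
qed

lemma tree_word_add: "tree_word (c + d) t = map ((+) c) (tree_word d t)"
  by (induction t arbitrary: d) (simp_all add: add.assoc)

lemma gcontains_tree_word_shift: "gcontains (tree_word c t) P \<longleftrightarrow> gcontains (tree_word 0 t) P"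
  using tree_word_add[of c 0 t] by (intro gcontains_order_cong) auto

text \<open>The largest letter occurs once and marks the root, so the words of the two subtrees can
  be read off.\<close>

lemma tree_word_eq_iff: "tree_word c t = tree_word c t' \<longleftrightarrow> t = t'"
proof
  assume "tree_word c t = tree_word c t'"
  then show "t = t'"
  proof (induction t arbitrary: c t')
    case Leaf
    then show ?case by (cases t') auto
  next
    case (Node l a r)
    then obtain l' a' r' where t': "t' = Node l' a' r'" by (cases t') auto
    have "size (Node l a r) = size t'"
      using Node.prems by (metis length_tree_word)
    then have n: "c + size l' + size r' + 1 = c + size l + size r + 1"
      by (simp add: t')
    have "tree_word (c + size r) l = tree_word (c + size r') l' \<and> tree_word c r = tree_word c r'"
      using Node.prems unfolding t' tree_word.simps n by (subst (asm) append_Cons_eq_iff) auto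
    then show ?case
      using Node.IH t' by auto
  qed
qed simp

text \<open>Shows that the letters on either side of the maximum again fill an interval, as the
  induction for surjectivity requires.\<close>

lemma initial_segment_eq:
  fixes A B :: "nat set"
  assumes "A \<union> B = {c<..c + m}" and less: "\<forall>x\<in>B. \<forall>y\<in>A. x < y"
  shows "B = {c<..c + card B}" and "A = {c + card B<..c + m}"
proof -
  have fin: "finite B"
    using assms(1) by (metis finite_Un finite_greaterThanAtMost)
  show B: "B = {c<..c + card B}"
  proof (cases "B = {}")
    case False
    have "B = {c<..Max B}"
    proof
      show "B \<subseteq> {c<..Max B}"
        using fin assms(1) by auto
      show "{c<..Max B} \<subseteq> B"
      proof
        fix x assume x: "x \<in> {c<..Max B}"
        have M: "Max B \<in> B" using fin False by simp
        then have "Max B \<le> c + m" using assms(1) by auto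
        then have "x \<in> A \<union> B" using x assms(1) by auto
        \<comment> \<open>An element of \<open>A\<close> would exceed \<open>Max B\<close>.\<close>
        then show "x \<in> B" using less M x by fastforce
      qed
    qed
    moreover have "c < Max B"
      using calculation False by (metis greaterThanAtMost_empty_iff not_less)
    moreover have "card B = Max B - c"
      using calculation(1) by (metis card_greaterThanAtMost)
    ultimately show ?thesis by simp
  qed simp
  have "A \<inter> B = {}" using less by blast
  then have "A = {c<..c + m} - B" using assms(1) by blast
  also have "\<dots> = {c + card B<..c + m}" by (subst B) auto
  finally show "A = {c + card B<..c + m}" .
qed

text \<open>Split at the maximum \<open>n\<close>: avoiding 1-3-2 puts \<open>\<sigma>\<close> above
  \<open>\<rho>\<close>, so both fill intervals and are coded by trees by induction.\<close>

lemma tree_word_surj: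
  assumes "distinct \<pi>" "set \<pi> = {c<..c + length \<pi>}" "gavoids \<pi> pat132"
  shows "\<exists>t. tree_word c t = \<pi>"
  using assms
proof (induction "length \<pi>" arbitrary: \<pi> c rule: less_induct)
  case less
  show ?case
  proof (cases "\<pi> = []")
    case True
    then show ?thesis by (intro exI[of _ Leaf]) simp
  next
    case False
    define n where "n = c + length \<pi>"
    then have "n \<in> set \<pi>"
      using False less.prems(2) by simp
    then obtain \<sigma> \<rho> where \<pi>: "\<pi> = \<sigma> @ n # \<rho>"
      by (meson split_list)
    have len: "n = c + length \<sigma> + length \<rho> + 1"
      using n_def \<pi> by simp
    have un: "set \<sigma> \<union> set \<rho> = {c<..c + (length \<sigma> + length \<rho>)}"
    proof -
      have "set \<sigma> \<union> set \<rho> = set \<pi> - {n}"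
        using less.prems(1) \<pi> by auto
      also have "\<dots> = {c<..n} - {n}"
        using less.prems(2) n_def by simp
      also have "\<dots> = {c<..c + (length \<sigma> + length \<rho>)}"
        unfolding len by auto
      finally show ?thesis .
    qed
    then have n: "\<forall>x\<in>set \<sigma> \<union> set \<rho>. x < n"
      using len by auto
    have av: "gavoids \<sigma> pat132" "gavoids \<rho> pat132"
      and nl: "\<not> (\<exists>x\<in>set \<sigma>. \<exists>y\<in>set \<rho>. x < y)"
      using less.prems(3) gcontains_pat132_max[OF n] unfolding \<pi> by blast+
    have lt: "\<forall>x\<in>set \<rho>. \<forall>y\<in>set \<sigma>. x < y"
      using nl less.prems(1) unfolding \<pi>
      by (metis IntI distinct.simps(2) distinct_append empty_iff list.set_intros(2)
        linorder_neqE_nat)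
    have card: "card (set \<rho>) = length \<rho>"
      using less.prems(1) \<pi> by (simp add: distinct_card)
    note seg = initial_segment_eq[OF un lt, unfolded card]
    obtain r where r: "tree_word c r = \<rho>"
      using less.hyps[of \<rho> c] seg(1) av(2) less.prems(1) \<pi> by auto
    have "set \<sigma> = {c + length \<rho><..c + length \<rho> + length \<sigma>}"
      using seg(2) by (simp add: ac_simps)
    then obtain l where l: "tree_word (c + length \<rho>) l = \<sigma>"
      using less.hyps[of \<sigma> "c + length \<rho>"] av(1) less.prems(1) \<pi> by auto
    have "size l = length \<sigma>" "size r = length \<rho>"
      using l r by (metis length_tree_word)+
    then have "tree_word c (Node l () r) = \<pi>"
      using l r \<pi> len by simp
    then show ?thesis by blast
  qed
qed

definition avoids_tree :: "gpattern \<Rightarrow> unit tree \<Rightarrow> bool" where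
  "avoids_tree P t \<longleftrightarrow> gavoids (tree_word 0 t) P"

text \<open>\<open>tree_word 0\<close> is a bijection onto the permutations avoiding 1-3-2, so only
  the condition for \<open>P\<close> is left.\<close>

lemma avoid_count_eq_card_trees: "avoid_count P n = card {t. size t = n \<and> avoids_tree P t}"
proof -
  have "bij_betw (tree_word 0) {t. size t = n \<and> avoids_tree P t}
    {\<pi> \<in> permutations_of_set {1..n}. gavoids \<pi> pat132 \<and> gavoids \<pi> P}"
  proof (rule bij_betw_imageI)
    show "inj_on (tree_word 0) {t. size t = n \<and> avoids_tree P t}"
      by (simp add: inj_on_def tree_word_eq_iff)
    have "\<pi> \<in> tree_word 0 ` {t. size t = n \<and> avoids_tree P t}"
      if \<pi>: "\<pi> \<in> permutations_of_set {1..n}" "gavoids \<pi> pat132" "gavoids \<pi> P" for \<pi>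
    proof -
      have d: "distinct \<pi>" "set \<pi> = {1..n}"
        using \<pi>(1) by (simp_all add: permutations_of_setD)
      then have len: "length \<pi> = n"
        using distinct_card[of \<pi>] by simp
      have "set \<pi> = {0<..0 + length \<pi>}"
        unfolding d(2) len by auto
      then obtain t where "tree_word 0 t = \<pi>" "size t = n"
        using tree_word_surj[OF d(1) _ \<pi>(2)] len by (metis length_tree_word)
      then show ?thesis
        using \<pi>(3) by (auto simp: avoids_tree_def)
    qed
    moreover have "tree_word 0 t \<in> permutations_of_set {1..size t}" for t
      by (auto simp: permutations_of_set_def distinct_tree_word)
    ultimately show "tree_word 0 ` {t. size t = n \<and> avoids_tree P t} =
        {\<pi> \<in> permutations_of_set {1..n}. gavoids \<pi> pat132 \<and> gavoids \<pi> P}"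
      using gavoids_pat132_tree_word by (auto simp: avoids_tree_def)
  qed
  from bij_betw_same_card[OF this] show ?thesis
    by (simp only: avoid_count_def)
qed

section \<open>Generating functions\<close>

text \<open>An arbitrary predicate is allowed because the decompositions also involve classes such
  as \<open>t = Leaf\<close>.\<close>

definition tree_gf :: "(unit tree \<Rightarrow> bool) \<Rightarrow> real fps" where
  "tree_gf Q = Abs_fps (\<lambda>n. real (card {t. size t = n \<and> Q t}))"

lemma avoid_gf_eq_tree_gf: "avoid_gf P = tree_gf (avoids_tree P)"
  by (simp add: avoid_gf_def tree_gf_def avoid_count_eq_card_trees)

text \<open>\<open>card\<close> is 0 on infinite sets, so finiteness must be known before
  cardinalities are added.\<close>

lemma finite_trees_size_le: "finite {t :: unit tree. size t \<le> n}"
proof (induction n)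
  case (Suc n)
  have "{t :: unit tree. size t \<le> Suc n} \<subseteq>
    insert Leaf ((\<lambda>(l, r). Node l () r) ` ({t. size t \<le> n} \<times> {t. size t \<le> n}))"
  proof
    fix t :: "unit tree" assume "t \<in> {t. size t \<le> Suc n}"
    then show "t \<in> insert Leaf ((\<lambda>(l, r). Node l () r) ` ({t. size t \<le> n} \<times> {t. size t \<le> n}))"
      by (cases t) auto
  qed
  then show ?case
    using Suc by (meson finite_SigmaI finite_imageI finite_insert finite_subset)
qed simp

lemma finite_trees_size [simp]: "finite {t :: unit tree. size t = n \<and> Q t}"
  by (rule finite_subset[OF _ finite_trees_size_le[of n]]) auto

lemma tree_gf_False: "tree_gf (\<lambda>_. False) = 0"
  by (simp add: tree_gf_def fps_eq_iff)

lemma tree_gf_Leaf: "tree_gf (\<lambda>t. t = Leaf) = 1"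
proof -
  have "{t :: unit tree. size t = n \<and> t = Leaf} = (if n = 0 then {Leaf} else {})" for n
    by auto
  then show ?thesis
    by (simp add: tree_gf_def fps_eq_iff)
qed

lemma tree_gf_disj:
  assumes "\<And>t. \<not> (Q t \<and> Q' t)"
  shows "tree_gf (\<lambda>t. Q t \<or> Q' t) = tree_gf Q + tree_gf Q'"
proof -
  have "card {t. size t = n \<and> (Q t \<or> Q' t)} =
        card {t. size t = n \<and> Q t} + card {t. size t = n \<and> Q' t}" for n
    using assms by (subst card_Un_disjoint[symmetric]) (auto intro!: arg_cong[of _ _ card])
  then show ?thesis
    by (simp add: tree_gf_def fps_eq_iff)
qed

text \<open>The root contributes \<open>fps_X\<close>; distributing the other nodes over two
  independent subtrees is a Cauchy product.\<close>

lemma tree_gf_Node: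
  "tree_gf (\<lambda>t. \<exists>l r. t = Node l () r \<and> Q l \<and> Q' r) = fps_X * (tree_gf Q * tree_gf Q')"
proof (rule fps_ext)
  fix n
  let ?S = "{t. size t = n \<and> (\<exists>l r. t = Node l () r \<and> Q l \<and> Q' r)}"
  show "tree_gf (\<lambda>t. \<exists>l r. t = Node l () r \<and> Q l \<and> Q' r) $ n =
        (fps_X * (tree_gf Q * tree_gf Q')) $ n"
  proof (cases n)
    case 0
    then have "?S = {}" by auto
    then show ?thesis
      using 0 by (simp add: tree_gf_def)
  next
    case (Suc k)
    \<comment> \<open>The size \<open>i\<close> of the left subtree is carried along so that the
      cardinality of \<open>?T\<close> is the convolution sum. It is determined by \<open>l\<close>,
      so dropping it is injective.\<close>
    let ?f = "\<lambda>(i :: nat, l, r). Node l () r"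
    let ?T = "SIGMA i:{0..k}. {l. size l = i \<and> Q l} \<times> {r. size r = k - i \<and> Q' r}"
    have "inj_on ?f ?T"
      by (auto simp: inj_on_def)
    moreover have "?f ` ?T = ?S"
    proof
      show "?S \<subseteq> ?f ` ?T"
      proof
        fix t assume "t \<in> ?S"
        then obtain l r where "t = Node l () r" "Q l" "Q' r" "size l + size r = k"
          using Suc by auto
        then show "t \<in> ?f ` ?T"
          by (intro image_eqI[of _ _ "(size l, l, r)"]) auto
      qed
    qed (use Suc in auto)
    ultimately have "card ?S = card ?T"
      using card_image[of ?f ?T] by argo
    also have "\<dots> = (\<Sum>i=0..k. card {l. size l = i \<and> Q l} * card {r. size r = k - i \<and> Q' r})"
      by (simp add: card_cartesian_product)
    finally show ?thesis
      using Suc by (simp add: tree_gf_def fps_mult_nth[of "Abs_fps _" "Abs_fps _"])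
  qed
qed

lemma tree_gf_rec:
  assumes "Q Leaf" "\<And>l r. Q (Node l () r) \<longleftrightarrow> Q1 l \<and> Q2 r"
  shows "tree_gf Q = 1 + fps_X * (tree_gf Q1 * tree_gf Q2)"
proof -
  have "Q = (\<lambda>t. t = Leaf \<or> (\<exists>l r. t = Node l () r \<and> Q1 l \<and> Q2 r))"
  proof
    fix t show "Q t \<longleftrightarrow> t = Leaf \<or> (\<exists>l r. t = Node l () r \<and> Q1 l \<and> Q2 r)"
      using assms by (cases t) auto
  qed
  then have "tree_gf Q = tree_gf (\<lambda>t. t = Leaf \<or> (\<exists>l r. t = Node l () r \<and> Q1 l \<and> Q2 r))"
    by (rule arg_cong)
  also have "\<dots> = tree_gf (\<lambda>t. t = Leaf) + tree_gf (\<lambda>t. \<exists>l r. t = Node l () r \<and> Q1 l \<and> Q2 r)"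
    by (rule tree_gf_disj) auto
  finally show ?thesis
    by (simp only: tree_gf_Leaf tree_gf_Node)
qed

section \<open>Functional equations for the generating functions\<close>

lemma avoids_tree_Leaf: "w \<noteq> [] \<Longrightarrow> avoids_tree (w, D) Leaf"
  by (simp add: avoids_tree_def gcontains_Nil)

lemma avoids_tree_empty_pattern: "avoids_tree ([], D) = (\<lambda>_. False)"
  by (simp add: fun_eq_iff avoids_tree_def gcontains_empty_pattern)

lemma tree_gf_avoids_snoc_dash:
  assumes w: "\<forall>x\<in>set w. x < m"
  shows "tree_gf (avoids_tree (w @ [m], insert (length w) D)) =
    1 + fps_X * (tree_gf (avoids_tree (w, D)) *
      tree_gf (avoids_tree (w @ [m], insert (length w) D)))"
proof (rule tree_gf_rec)
  fix l r :: "unit tree"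
  show "avoids_tree (w @ [m], insert (length w) D) (Node l () r) \<longleftrightarrow>
    avoids_tree (w, D) l \<and> avoids_tree (w @ [m], insert (length w) D) r"
    unfolding avoids_tree_def tree_word.simps
    by (subst gcontains_snoc_dash_max[OF w])
      (auto simp: gcontains_tree_word_shift[of "size r" l])
qed (simp add: avoids_tree_Leaf)

text \<open>
  \<open>G\<close> below counts the words that still avoid the pattern when a new maximum is appended; it is
  eliminated from the two equations \<open>F = 1 + x G F\<close> and \<open>G = 1 + x B + x G (G - 1)\<close>.
\<close>

lemma tree_gf_avoids_ascent:
  assumes w: "\<forall>x\<in>set w. x < m" "m < m'" "D \<subseteq> {..length w}"
  defines "F \<equiv> tree_gf (avoids_tree (w @ [m, m'], insert (length w) D))"
    and "B \<equiv> tree_gf (avoids_tree (w, D))"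
  shows "F = 1 + fps_X * F + fps_X\<^sup>2 * B * F\<^sup>2"
proof -
  let ?P = "(w @ [m, m'], insert (length w) D)"
  \<comment> \<open>\<open>Node t () Leaf\<close> codes the word of \<open>t\<close> followed by a
    new maximum.\<close>
  define Q where "Q t \<longleftrightarrow> avoids_tree ?P (Node t () Leaf)" for t
  define G where "G = tree_gf Q"
  have Q_shift: "gavoids (tree_word c t @ [c + size t + 1]) ?P \<longleftrightarrow> Q t" for c t
    using gcontains_tree_word_shift[of c "Node t () Leaf" ?P] by (simp add: Q_def avoids_tree_def)
  have F: "F = 1 + fps_X * (G * F)"
    unfolding F_def G_def
  proof (rule tree_gf_rec)
    fix l r :: "unit tree"
    \<comment> \<open>The cut is made right after the maximum, where a nonempty right part starts
      with a descent.\<close>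
    have "gcontains (tree_word 0 (Node l () r)) ?P \<longleftrightarrow>
      gcontains (tree_word (size r) l @ [size r + size l + 1]) ?P \<or> gcontains (tree_word 0 r) ?P"
    proof -
      have "tree_word 0 r ! j < y" if "j < size r" "y \<in> set (tree_word (size r) l @ [size r + size l + 1])"
        for j y
      proof -
        have "tree_word 0 r ! j \<in> set (tree_word 0 r)"
          using that(1) by (intro nth_mem) simp
        then show ?thesis using that(2) by auto
      qed
      moreover have "hd (tree_word 0 r) < size r + size l + 1" if "tree_word 0 r \<noteq> []"
        using hd_in_set[OF that] by simp
      ultimately have "gcontains ((tree_word (size r) l @ [size r + size l + 1]) @ tree_word 0 r) ?P \<longleftrightarrow>
        gcontains (tree_word (size r) l @ [size r + size l + 1]) ?P \<or> gcontains (tree_word 0 r) ?P"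
        by (intro gcontains_ascent_append[OF w]) auto
      then show ?thesis by (simp add: add.commute)
    qed
    then show "avoids_tree ?P (Node l () r) \<longleftrightarrow> Q l \<and> avoids_tree ?P r"
      using Q_shift by (auto simp: avoids_tree_def)
  qed (simp add: avoids_tree_Leaf)
  have Q_Leaf: "Q Leaf"
    unfolding Q_def avoids_tree_def by (auto simp: gcontains_append_ascent_iff[OF w])
  \<comment> \<open>Here the old and the new maximum are adjacent and form an ascent, so
    \<open>l\<close> must avoid \<open>w\<close> itself.\<close>
  have Q_Node_Leaf: "Q (Node l () Leaf) \<longleftrightarrow> avoids_tree (w, D) l" for l
    unfolding Q_def avoids_tree_def
    using gcontains_ascent_snoc_max[OF w, of "tree_word 0 l" "Suc (size l)" "Suc (Suc (size l))"]
    by simp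
  \<comment> \<open>The cut follows the old maximum and is a descent because \<open>r\<close> is
    nonempty. The right part is \<open>r\<close> with the new maximum as its last letter, the only
    one above the left part.\<close>
  have Q_Node: "Q (Node l () r) \<longleftrightarrow> Q l \<and> Q r" if r: "r \<noteq> Leaf" for l r
  proof -
    let ?\<alpha> = "tree_word (size r) l @ [size r + size l + 1]"
    let ?n = "size l + size r + 2"
    have pos: "0 < size r" using r by (cases r) auto
    have "(tree_word 0 r @ [?n]) ! j < y" if "j < size r" "y \<in> set ?\<alpha>" for j y
    proof -
      have "tree_word 0 r ! j \<in> set (tree_word 0 r)"
        using that(1) by (intro nth_mem) simp
      then show ?thesis using that by (auto simp: nth_append)
    qed
    moreover have "hd (tree_word 0 r @ [?n]) < size r + size l + 1"
    proof -
      have "tree_word 0 r \<noteq> []" using pos by (metis length_tree_word list.size(3) less_irrefl)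
      then show ?thesis using hd_in_set[of "tree_word 0 r"] by simp
    qed
    ultimately have "gcontains (?\<alpha> @ tree_word 0 r @ [?n]) ?P \<longleftrightarrow>
        gcontains ?\<alpha> ?P \<or> gcontains (tree_word 0 r @ [?n]) ?P"
      by (intro gcontains_ascent_append[OF w]) auto
    moreover have "gcontains (tree_word 0 r @ [?n]) ?P \<longleftrightarrow>
        gcontains (tree_word 0 r @ [0 + size r + 1]) ?P"
      by (rule gcontains_snoc_max_cong) auto
    moreover have "tree_word 0 (Node (Node l () r) () Leaf) = ?\<alpha> @ tree_word 0 r @ [?n]"
      by simp
    ultimately show ?thesis
      using Q_shift[of "size r" l] Q_shift[of 0 r] unfolding Q_def[of "Node l () r"] avoids_tree_def
      by (simp add: add.commute)
  qed
  have "Q = (\<lambda>t. (t = Leaf \<or> (\<exists>l r. t = Node l () r \<and> avoids_tree (w, D) l \<and> r = Leaf)) \<or>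
      (\<exists>l r. t = Node l () r \<and> Q l \<and> (Q r \<and> r \<noteq> Leaf)))" (is "_ = (\<lambda>t. ?Q1 t \<or> ?Q2 t)")
  proof
    fix t show "Q t \<longleftrightarrow> ?Q1 t \<or> ?Q2 t"
    proof (cases t)
      case (Node l a r)
      then show ?thesis
        using Q_Node_Leaf[of l] Q_Node[of r l] by (cases "r = Leaf") auto
    qed (simp add: Q_Leaf)
  qed
  then have "G = tree_gf (\<lambda>t. ?Q1 t \<or> ?Q2 t)"
    unfolding G_def by (rule arg_cong)
  also have "\<dots> = tree_gf ?Q1 + tree_gf ?Q2"
    by (rule tree_gf_disj) auto
  also have "tree_gf ?Q1 = tree_gf (\<lambda>t. t = Leaf) +
      tree_gf (\<lambda>t. \<exists>l r. t = Node l () r \<and> avoids_tree (w, D) l \<and> r = Leaf)"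
    by (rule tree_gf_disj) auto
  finally have "G = 1 + fps_X * B + fps_X * (G * tree_gf (\<lambda>t. Q t \<and> t \<noteq> Leaf))"
    unfolding tree_gf_Leaf tree_gf_Node B_def[symmetric] G_def[symmetric] mult_1_right .
  \<comment> \<open>\<open>Leaf\<close> satisfies \<open>Q\<close>, so the nonempty right subtrees
    contribute \<open>G - 1\<close>.\<close>
  moreover have "G = tree_gf (\<lambda>t. Q t \<and> t \<noteq> Leaf) + 1"
  proof -
    have "Q = (\<lambda>t. (Q t \<and> t \<noteq> Leaf) \<or> t = Leaf)"
      using Q_Leaf by auto
    then have "G = tree_gf (\<lambda>t. (Q t \<and> t \<noteq> Leaf) \<or> t = Leaf)"
      unfolding G_def by (rule arg_cong)
    also have "\<dots> = tree_gf (\<lambda>t. Q t \<and> t \<noteq> Leaf) + tree_gf (\<lambda>t. t = Leaf)"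
      by (rule tree_gf_disj) auto
    finally show ?thesis by (simp only: tree_gf_Leaf)
  qed
  ultimately have "G = 1 + fps_X * B + fps_X * (G * (G - 1))"
    by (metis add_diff_cancel_right')
  \<comment> \<open>Multiply the equation for \<open>G\<close> by \<open>fps_X * F\<^sup>2\<close>
    and replace \<open>fps_X * G * F\<close> by \<open>F - 1\<close>.\<close>
  with F show ?thesis by algebra
qed

text \<open>Nothing may follow a maximum, so all right subtrees are empty: only the increasing
  permutations remain.\<close>

lemma tree_gf_avoids_descent:
  assumes "D \<subseteq> {1}"
  shows "tree_gf (avoids_tree ([2, 1], D)) = 1 + fps_X * tree_gf (avoids_tree ([2, 1], D))"
proof -
  have "tree_gf (avoids_tree ([2, 1], D)) =
      1 + fps_X * (tree_gf (avoids_tree ([2, 1], D)) * tree_gf (\<lambda>t. t = Leaf))"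
  proof (rule tree_gf_rec)
    fix l r :: "unit tree"
    have "tree_word 0 r = [] \<longleftrightarrow> r = Leaf"
      using tree_word_eq_iff[of 0 r Leaf] by simp
    then show "avoids_tree ([2, 1], D) (Node l () r) \<longleftrightarrow> avoids_tree ([2, 1], D) l \<and> r = Leaf"
      unfolding avoids_tree_def tree_word.simps
      by (subst gcontains_descent_max[OF assms])
        (auto simp: gcontains_tree_word_shift[of "size r" l])
  qed (simp add: avoids_tree_Leaf)
  then show ?thesis
    by (simp add: tree_gf_Leaf)
qed

section \<open>Prefixes counted by the Chebyshev quotients\<close>

text \<open>The last conjunct says that the generating function is \<open>R\<^sub>p\<close>.\<close>

definition chebyshev_pattern :: "nat \<Rightarrow> nat list \<Rightarrow> nat set \<Rightarrow> bool" where
  "chebyshev_pattern p w D \<longleftrightarrow> p \<ge> 1 \<and> length w = p \<and> (\<forall>x\<in>set w. x < Suc p) \<and> D \<subseteq> {..p} \<and>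
     tree_gf (avoids_tree (w, D)) * cheb_den p = cheb_den (p - 1)"

text \<open>The generating function \<open>B\<close> becomes \<open>1 / (1 - fps_X * B)\<close>, and
  \<open>cheb_den\<close> satisfies the matching three-term recursion.\<close>

lemma chebyshev_pattern_snoc_dash:
  assumes "chebyshev_pattern p w D"
  shows "chebyshev_pattern (Suc p) (w @ [Suc p]) (insert p D)"
proof -
  define B where "B = tree_gf (avoids_tree (w, D))"
  define B' where "B' = tree_gf (avoids_tree (w @ [Suc p], insert p D))"
  obtain q where p: "p = Suc q"
    using assms by (cases p) (auto simp: chebyshev_pattern_def)
  have "B' = 1 + fps_X * (B * B')"
    using tree_gf_avoids_snoc_dash[of w "Suc p" D] assms
    by (auto simp: B_def B'_def chebyshev_pattern_def)
  moreover have "B * cheb_den p = cheb_den q"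
    using assms by (simp add: B_def chebyshev_pattern_def p)
  moreover have "cheb_den (Suc p) = cheb_den p - fps_X * cheb_den q"
    by (simp add: p)
  \<comment> \<open>Multiplying the equation for \<open>B'\<close> by \<open>cheb_den p\<close> and
    putting \<open>cheb_den q\<close> for \<open>B * cheb_den p\<close> gives this without any
    division.\<close>
  ultimately have "B' * cheb_den (Suc p) = cheb_den p"
    by algebra
  then show ?thesis
    using assms by (auto simp: chebyshev_pattern_def B'_def less_Suc_eq)
qed

text \<open>Only the empty permutation avoids a single letter. In the dash recursion this is the
  case of empty \<open>w\<close>, whose generating function is 0.\<close>

lemma chebyshev_pattern_1: "chebyshev_pattern 1 [1] {}"
proof -
  have "avoids_tree ([1], {}) = avoids_tree ([] @ [1], insert (length ([] :: nat list)) {})"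
    using gcontains_dash_cong[of "[1]" "{}" "{0}"] by (simp add: avoids_tree_def fun_eq_iff)
  then show ?thesis
    using tree_gf_avoids_snoc_dash[of "[]" 1 "{}"]
    by (simp add: chebyshev_pattern_def avoids_tree_empty_pattern tree_gf_False)
qed

lemma cheb_den_2: "cheb_den 2 = 1 - fps_X"
  by (simp add: numeral_2_eq_2)

text \<open>For empty \<open>w\<close> the quadratic equation becomes linear: every word contains
  the empty pattern, so its quadratic coefficient vanishes.\<close>

lemma chebyshev_pattern_12: "chebyshev_pattern 2 [1, 2] {}"
proof -
  have "avoids_tree ([1, 2], {}) = avoids_tree ([] @ [1, 2], insert (length ([] :: nat list)) {})"
    using gcontains_dash_cong[of "[1, 2]" "{}" "{0}"] by (simp add: avoids_tree_def fun_eq_iff)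
  then have "tree_gf (avoids_tree ([1, 2], {})) = 1 + fps_X * tree_gf (avoids_tree ([1, 2], {}))"
    using tree_gf_avoids_ascent[of "[]" 1 2 "{}"]
    by (simp add: avoids_tree_empty_pattern tree_gf_False)
  then have "tree_gf (avoids_tree ([1, 2], {})) * (1 - fps_X) = 1"
    by algebra
  then show ?thesis
    by (simp add: chebyshev_pattern_def cheb_den_2)
qed

lemma chebyshev_pattern_21:
  assumes "D \<subseteq> {1}"
  shows "chebyshev_pattern 2 [2, 1] D"
proof -
  have "tree_gf (avoids_tree ([2, 1], D)) * (1 - fps_X) = 1"
    using tree_gf_avoids_descent[OF assms] by algebra
  then show ?thesis
    using assms by (auto simp: chebyshev_pattern_def cheb_den_2)
qed

lemma chebyshev_pattern_upt:
  assumes "chebyshev_pattern q w D" and "p \<ge> q"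
  shows "chebyshev_pattern p (w @ [Suc q..<Suc p]) (D \<union> {q..<p})"
  using assms(2)
proof (induction p rule: dec_induct)
  case (step p)
  have "insert p (D \<union> {q..<p}) = D \<union> {q..<Suc p}"
    using step.hyps by auto
  then show ?case
    using chebyshev_pattern_snoc_dash[OF step.IH] step.hyps by simp
qed (use assms(1) in simp)

section \<open>Solving the quadratic equation\<close>

text \<open>Completing the square exhibits \<open>S\<close> as a square root of the discriminant;
  its constant term 1 selects the branch.\<close>

lemma fps_eq_of_quadratic:
  fixes F R :: "real fps"
  assumes F: "F = 1 + fps_X * F + fps_X\<^sup>2 * R * F\<^sup>2" and "R \<noteq> 0"
  shows "F = (1 - fps_X - fps_sqrt (1 - 2 * fps_X + fps_X\<^sup>2 - 4 * fps_X\<^sup>2 * R)) /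
    (2 * fps_X\<^sup>2 * R)"
proof -
  define S where "S = 1 - fps_X - 2 * fps_X\<^sup>2 * R * F"
  define b where "b = 1 - 2 * fps_X + fps_X\<^sup>2 - 4 * fps_X\<^sup>2 * R"
  \<comment> \<open>The equation for \<open>F\<close> reads
    \<open>(1 - fps_X) * F - fps_X\<^sup>2 * R * F\<^sup>2 = 1\<close>, so the terms of the square
    that contain \<open>F\<close> collapse to \<open>- 4 * fps_X\<^sup>2 * R\<close>.\<close>
  have sq: "S ^ Suc 1 = b"
    using F unfolding S_def b_def One_nat_def numeral_2_eq_2[symmetric] by algebra
  have S0: "S $ 0 = 1" and b0: "b $ 0 = 1"
    by (simp_all add: S_def b_def fps_mult_nth)
  have "S = fps_radical root (Suc 1) b"
    using sq S0 b0 by (subst (asm) radical_unique[where r = root]) simp_all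
  then have "fps_sqrt b = S"
    by (simp add: fps_sqrt_def numeral_2_eq_2)
  then have "1 - fps_X - fps_sqrt b = (2 * fps_X\<^sup>2 * R) * F"
    by (simp add: S_def)
  moreover have "2 * fps_X\<^sup>2 * R \<noteq> 0"
    using \<open>R \<noteq> 0\<close> by simp
  ultimately show ?thesis
    unfolding b_def[symmetric] by simp
qed

text \<open>The coefficient \<open>B\<close> in the quadratic equation is identified with
  \<open>cheb_R p\<close> through the quotient of the \<open>cheb_den\<close>.\<close>

lemma avoid_gf_chebyshev_pattern:
  assumes "chebyshev_pattern p w D"
  shows "avoid_gf (w @ [Suc p, Suc (Suc p)], insert p D) =
    (1 - fps_X - fps_sqrt (1 - 2 * fps_X + fps_X\<^sup>2 - 4 * fps_X\<^sup>2 * cheb_R p)) /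
    (2 * fps_X\<^sup>2 * cheb_R p)"
proof (rule fps_eq_of_quadratic)
  define B where "B = tree_gf (avoids_tree (w, D))"
  have p: "p \<ge> 1" "length w = p" "\<forall>x\<in>set w. x < Suc p" "D \<subseteq> {..p}"
    and B: "B * cheb_den p = cheb_den (p - 1)"
    using assms by (auto simp: chebyshev_pattern_def B_def)
  have nz: "cheb_den q \<noteq> 0" for q
    using cheb_den_nth_0[of q] by (metis fps_zero_nth zero_neq_one)
  have R: "cheb_R p = B"
    unfolding cheb_R_eq(2)[OF p(1)] B[symmetric] using nz by simp
  show "cheb_R p \<noteq> 0"
    using B nz unfolding R by (metis mult_zero_left)
  show "avoid_gf (w @ [Suc p, Suc (Suc p)], insert p D) =
    1 + fps_X * avoid_gf (w @ [Suc p, Suc (Suc p)], insert p D) +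
    fps_X\<^sup>2 * cheb_R p * (avoid_gf (w @ [Suc p, Suc (Suc p)], insert p D))\<^sup>2"
    using tree_gf_avoids_ascent[of w "Suc p" "Suc (Suc p)" D] p
    unfolding R B_def avoid_gf_eq_tree_gf by simp
qed

theorem theorem2p9:
  fixes k :: nat and P :: gpattern
  assumes "k \<ge> 3"
    and "P = pat_1_2 k \<or> (k \<ge> 4 \<and> P \<in> {pat_12 k, pat_2_1 k, pat_21 k})"
  shows "avoid_gf P =
    (1 - fps_X - fps_sqrt (1 - 2 * fps_X + fps_X\<^sup>2 - 4 * fps_X\<^sup>2 * cheb_R (k - 2))) /
    (2 * fps_X\<^sup>2 * cheb_R (k - 2))"
proof -
  define p where "p = k - 2"
  have k: "k = Suc (Suc p)" and p: "p \<ge> 1"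
    using assms(1) by (auto simp: p_def)
  have upt_k: "[q..<Suc k] = [q..<Suc p] @ [Suc p, Suc (Suc p)]" if "q \<le> Suc p" for q
    using that by (simp add: k)
  \<comment> \<open>Each pattern is a base of one or two letters, extended by dashed letters up to
    length \<open>p\<close> and then by the final ascent.\<close>
  have "\<exists>w D. chebyshev_pattern p w D \<and> P = (w @ [Suc p, Suc (Suc p)], insert p D)"
    using assms(2)
  proof (elim disjE conjE)
    assume P: "P = pat_1_2 k"
    \<comment> \<open>The dashes in \<open>{1..<p}\<close> come from the letters appended to the
      base \<open>[1]\<close>; \<open>p\<close> is the dash before the final ascent.\<close>
    have "insert p ({} \<union> {1..<p}) = {1..p}" using p by auto
    moreover have "[1..<Suc k] = ([1] @ [Suc 1..<Suc p]) @ [Suc p, Suc (Suc p)]"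
      using p by (subst upt_k) (simp_all add: upt_conv_Cons del: upt_Suc)
    ultimately show ?thesis
      using chebyshev_pattern_upt[OF chebyshev_pattern_1 p] P unfolding pat_1_2_def p_def[symmetric]
      by metis
  next
    assume "k \<ge> 4" and P: "P \<in> {pat_12 k, pat_2_1 k, pat_21 k}"
    \<comment> \<open>A base of two letters fits only if \<open>p \<ge> 2\<close>, which is
      \<open>k \<ge> 4\<close>.\<close>
    then have p2: "p \<ge> 2" by (simp add: k)
    \<comment> \<open>The first equation serves the bases 12 and 21, the second one 2-1, whose own
      dash is at 1.\<close>
    have D: "insert p ({} \<union> {2..<p}) = {2..p}" "insert p ({1} \<union> {2..<p}) = {1..p}"
      using p2 by auto
    have upt: "[1..<Suc k] = ([1, 2] @ [Suc 2..<Suc p]) @ [Suc p, Suc (Suc p)]"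
      "[2, 1] @ [3..<Suc k] = ([2, 1] @ [Suc 2..<Suc p]) @ [Suc p, Suc (Suc p)]"
      using p2 by (simp_all add: upt_k upt_conv_Cons numeral_3_eq_3 numeral_2_eq_2 del: upt_Suc)
    from P show ?thesis
    proof (elim insertE emptyE)
      assume "P = pat_12 k"
      then show ?thesis
        using chebyshev_pattern_upt[OF chebyshev_pattern_12 p2] D(1) upt(1)
        unfolding pat_12_def p_def[symmetric] by metis
    next
      assume "P = pat_2_1 k"
      then show ?thesis
        using chebyshev_pattern_upt[OF chebyshev_pattern_21 p2, of "{1}"] D(2) upt(2)
        unfolding pat_2_1_def p_def[symmetric] by (metis order_refl)
    next
      assume "P = pat_21 k"
      then show ?thesis
        using chebyshev_pattern_upt[OF chebyshev_pattern_21 p2, of "{}"] D(1) upt(2)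
        unfolding pat_21_def p_def[symmetric] by (metis empty_subsetI)
    qed
  qed
  then show ?thesis
    using avoid_gf_chebyshev_pattern unfolding p_def[symmetric] by blast
qed

end
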